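(* Suppose there exists a difference scheme $DS(m,s;x)$ with $s\ge2$ (so $m=xs$). Then there exists a Latin semi-regular, affine resolvable, STD$(s)$ rectangular design with parameters $v=xs^2$, $b=s(xs-1)$, $r=xs-1$, $k=xs$, $\lambda_1=0$, $\lambda_2=x-1$, $\lambda_3=x$, intersection numbers $q_1=0$, $q_2=x$, and array dimensions $m=xs$, $n=s$.
   Context: For $s\ge2$ let $\mathbb{Z}_s$ be the additive cyclic group of order $s$. A difference scheme $DS(m,s;x)$ is an $m\times m$ matrix with entries in $\mathbb{Z}_s$ such that, for any two distinct columns, the entrywise differences (mod $s$) contain each element of $\mathbb{Z}_s$ exactly $x$ times. A rectangular design (RD) with parameters $v=mn,b,r,k,\lambda_1,\lambda_2,\lambda_3,m,n$ has its treatments arranged in an $m\times n$ array, $b$ blocks of size $k$, replication $r$, and any two distinct treatments occur together in $\lambda_1$ blocks if in the same row, $\lambda_2$ if in the same column, $\lambda_3$ otherwise. It is Latin semi-regular if $\theta_1=\theta_2=0<\theta_3$, where $\theta_1=r-\lambda_1+(m-1)(\lambda_2-\lambda_3)$, $\theta_2=r-\lambda_2+(n-1)(\lambda_1-\lambda_3)$, $\theta_3=r-\lambda_1-\lambda_2+\lambda_3$. A resolvable design (blocks partitioned into classes each containing every treatment exactly once) is affine resolvable if any two distinct blocks of the same class meet in $q_1$ treatments and any two blocks from different classes meet in $q_2$ treatments. It is STD$(s)$ if its incidence matrix (rows grouped by rows of the array) is partitioned into $s\times s$ submatrices each with constant row sums and constant column sums. *)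

theory Defs
  imports Main "HOL-Library.Disjoint_Sets" "Jordan_Normal_Form.Matrix"
begin

text \<open>The group \<open>\<int>\<^sub>s\<close> is represented by the residues \<open>{0..<s}\<close>. For \<open>m < 2\<close> there are no two
  distinct columns, so the condition is vacuous and does not force \<open>m = x * s\<close>.\<close>

definition difference_scheme :: "nat \<Rightarrow> nat \<Rightarrow> nat \<Rightarrow> int mat \<Rightarrow> bool" where
  "difference_scheme m s x D \<longleftrightarrow>
     D \<in> carrier_mat m m \<and> elements_mat D \<subseteq> {0..<int s} \<and>
     (\<forall>c<m. \<forall>c'<m. c \<noteq> c' \<longrightarrow>
        (\<forall>g\<in>{0..<int s}. card {i. i < m \<and> (D $$ (i, c) - D $$ (i, c')) mod int s = g} = x))"

text \<open>Treatments are the cells \<open>(i, j)\<close> of the array, \<open>i\<close> being the row and \<open>j\<close> the column. Blocks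
  are an indexed family \<open>B 0, \<dots>, B (b - 1)\<close>, so repeated blocks are allowed.\<close>

definition treatments :: "nat \<Rightarrow> nat \<Rightarrow> (nat \<times> nat) set" where
  "treatments m n = {..<m} \<times> {..<n}"

definition rectangular_design ::
  "nat \<Rightarrow> nat \<Rightarrow> nat \<Rightarrow> nat \<Rightarrow> nat \<Rightarrow> nat \<Rightarrow> nat \<Rightarrow> nat \<Rightarrow> nat \<Rightarrow> (nat \<Rightarrow> (nat \<times> nat) set) \<Rightarrow> bool" where
  "rectangular_design v b r k l1 l2 l3 m n B \<longleftrightarrow>
     v = m * n \<and>
     (\<forall>j<b. B j \<subseteq> treatments m n \<and> card (B j) = k) \<and>
     (\<forall>t\<in>treatments m n. card {j. j < b \<and> t \<in> B j} = r) \<and>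
     (\<forall>t\<in>treatments m n. \<forall>u\<in>treatments m n. t \<noteq> u \<longrightarrow>
        card {j. j < b \<and> t \<in> B j \<and> u \<in> B j} =
          (if fst t = fst u then l1 else if snd t = snd u then l2 else l3))"

definition theta1 :: "nat \<Rightarrow> nat \<Rightarrow> nat \<Rightarrow> nat \<Rightarrow> nat \<Rightarrow> int" where
  "theta1 r l1 l2 l3 m = int r - int l1 + (int m - 1) * (int l2 - int l3)"

definition theta2 :: "nat \<Rightarrow> nat \<Rightarrow> nat \<Rightarrow> nat \<Rightarrow> nat \<Rightarrow> int" where
  "theta2 r l1 l2 l3 n = int r - int l2 + (int n - 1) * (int l1 - int l3)"

definition theta3 :: "nat \<Rightarrow> nat \<Rightarrow> nat \<Rightarrow> nat \<Rightarrow> int" where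
  "theta3 r l1 l2 l3 = int r - int l1 - int l2 + int l3"

definition latin_semi_regular :: "nat \<Rightarrow> nat \<Rightarrow> nat \<Rightarrow> nat \<Rightarrow> nat \<Rightarrow> nat \<Rightarrow> bool" where
  "latin_semi_regular r l1 l2 l3 m n \<longleftrightarrow>
     theta1 r l1 l2 l3 m = 0 \<and> theta2 r l1 l2 l3 n = 0 \<and> 0 < theta3 r l1 l2 l3"

definition is_resolution ::
  "nat \<Rightarrow> nat \<Rightarrow> nat \<Rightarrow> (nat \<Rightarrow> (nat \<times> nat) set) \<Rightarrow> nat set set \<Rightarrow> bool" where
  "is_resolution m n b B P \<longleftrightarrow>
     partition_on {..<b} P \<and> (\<forall>C\<in>P. \<forall>t\<in>treatments m n. \<exists>!j. j \<in> C \<and> t \<in> B j)"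

definition affine_resolvable ::
  "nat \<Rightarrow> nat \<Rightarrow> nat \<Rightarrow> (nat \<Rightarrow> (nat \<times> nat) set) \<Rightarrow> nat \<Rightarrow> nat \<Rightarrow> bool" where
  "affine_resolvable m n b B q1 q2 \<longleftrightarrow>
     (\<exists>P. is_resolution m n b B P \<and>
        (\<forall>C\<in>P. \<forall>i\<in>C. \<forall>j\<in>C. i \<noteq> j \<longrightarrow> card (B i \<inter> B j) = q1) \<and>
        (\<forall>C\<in>P. \<forall>C'\<in>P. C \<noteq> C' \<longrightarrow> (\<forall>i\<in>C. \<forall>j\<in>C'. card (B i \<inter> B j) = q2)))"

text \<open>The treatments are listed array row by array row, so for \<open>n = s\<close> the groups of \<open>s\<close>
  consecutive rows of the incidence matrix are exactly the rows of the array.\<close>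

definition incidence_mat :: "nat \<Rightarrow> nat \<Rightarrow> nat \<Rightarrow> (nat \<Rightarrow> (nat \<times> nat) set) \<Rightarrow> nat mat" where
  "incidence_mat m n b B =
     mat (m * n) b (\<lambda>(p, j). if (p div n, p mod n) \<in> B j then 1 else 0)"

definition square_tactical :: "nat \<Rightarrow> nat mat \<Rightarrow> bool" where
  "square_tactical s N \<longleftrightarrow>
     0 < s \<and> s dvd dim_row N \<and> s dvd dim_col N \<and>
     (\<forall>I < dim_row N div s. \<forall>J < dim_col N div s.
        (\<exists>\<rho>. \<forall>p<s. (\<Sum>q<s. N $$ (I * s + p, J * s + q)) = \<rho>) \<and>
        (\<exists>\<kappa>. \<forall>q<s. (\<Sum>p<s. N $$ (I * s + p, J * s + q)) = \<kappa>))"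

definition STD :: "nat \<Rightarrow> nat \<Rightarrow> nat \<Rightarrow> nat \<Rightarrow> (nat \<Rightarrow> (nat \<times> nat) set) \<Rightarrow> bool" where
  "STD s m n b B \<longleftrightarrow> square_tactical s (incidence_mat m n b B)"

end

theory Submission
  imports Defs "HOL-Number_Theory.Cong"
begin

text \<open>Subtracting the last column of the difference scheme from every column makes the last column
  zero and keeps all column differences. Every remaining column \<open>c\<close> gives a parallel class: the
  graph \<open>{(i, D i c)}\<close> and its \<open>s\<close> vertical translates. Two blocks of different classes meet in \<open>x\<close>
  treatments because column differences are uniform; the concurrences of treatments count row
  differences. Row differences are uniform as well: for a fixed row \<open>i\<close>, double counting gives the
  sum and the sum of squares of the numbers of times the difference of rows \<open>i\<close> and \<open>i'\<close> takes
  the value \<open>h\<close>, and the resulting variance around \<open>x\<close> vanishes. The deleted zero column is what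
  turns \<open>x\<close> into \<open>x - 1\<close> for treatments in the same array column.\<close>

section \<open>Uniformity of row differences\<close>

lemma sum_card_fibres:
  assumes "finite A" "finite S" "f ` A \<subseteq> S"
  shows "(\<Sum>h\<in>S. card {a\<in>A. f a = h}) = card A"
  using sum.group[OF assms, of "\<lambda>_. 1::nat"] by simp

text \<open>Both sides count the ordered pairs on which \<open>f\<close> agrees, so second moments
  become counts of coincidences.\<close>

lemma sum_card_fibres_squared:
  assumes "finite A" "finite S" "f ` A \<subseteq> S"
  shows "(\<Sum>h\<in>S. (card {a\<in>A. f a = h})\<^sup>2) = (\<Sum>a\<in>A. card {a'\<in>A. f a' = f a})"
proof -
  have "(\<Sum>a\<in>A. card {a'\<in>A. f a' = f a}) =
      (\<Sum>h\<in>S. \<Sum>a\<in>{a\<in>A. f a = h}. card {a'\<in>A. f a' = f a})"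
    by (rule sum.group[OF assms, symmetric])
  also have "\<dots> = (\<Sum>h\<in>S. (card {a\<in>A. f a = h})\<^sup>2)"
    by (rule sum.cong) (auto simp: power2_eq_square)
  finally show ?thesis by simp
qed

lemma sum_card_swap:
  assumes "finite A" "finite B"
  shows "(\<Sum>a\<in>A. card {b\<in>B. P a b}) = (\<Sum>b\<in>B. card {a\<in>A. P a b})"
  using sum.swap_restrict[OF assms, of "\<lambda>_ _. 1::nat" P] by simp

lemma sum_off_diagonal:
  fixes p q :: nat
  assumes "c < m"
  shows "(\<Sum>c'<m. if c' = c then p else q) = p + (m - 1) * q"
proof -
  have "(\<Sum>c'<m. if c' = c then p else q) =
      p + (\<Sum>c'\<in>{..<m} - {c}. if c' = c then p else q)"
    using assms by (subst sum.remove[of _ c]) auto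
  also have "(\<Sum>c'\<in>{..<m} - {c}. if c' = c then p else q) = (\<Sum>c'\<in>{..<m} - {c}. q)"
    by (rule sum.cong) auto
  finally show ?thesis using assms by simp
qed

text \<open>A congruence depends only on the difference of its sides up to sign; every rearrangement
  then reduces to a linear identity.\<close>

lemma cong_iff_neg_diff:
  fixes p q a b n :: int
  assumes "p - a = - (q - b)"
  shows "[p = a] (mod n) \<longleftrightarrow> [q = b] (mod n)"
  unfolding cong_iff_dvd_diff assms by (rule dvd_minus_iff)

text \<open>Congruences with arbitrary integer \<open>g\<close> replace canonical residues, since
  subtracting the last column can push entries outside \<open>{0..<int s}\<close>.\<close>

definition uniform_columns :: "nat \<Rightarrow> nat \<Rightarrow> nat \<Rightarrow> (nat \<Rightarrow> nat \<Rightarrow> int) \<Rightarrow> bool" where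
  "uniform_columns m s x E \<longleftrightarrow>
     (\<forall>c<m. \<forall>c'<m. \<forall>g. c \<noteq> c' \<longrightarrow> card {i\<in>{..<m}. [E i c - E i c' = g] (mod int s)} = x)"

lemma uniform_columnsD:
  assumes "uniform_columns m s x E" "c < m" "c' < m" "c \<noteq> c'"
  shows "card {i\<in>{..<m}. [E i c - E i c' = g] (mod int s)} = x"
  using assms unfolding uniform_columns_def by blast

lemma uniform_columns_order:
  assumes E: "uniform_columns m s x E" and "0 < s" "2 \<le> m"
  shows "m = x * s"
proof -
  have "m = (\<Sum>h\<in>{0..<int s}. card {i\<in>{..<m}. (E i 0 - E i 1) mod int s = h})"
    using sum_card_fibres[of "{..<m}" "{0..<int s}" "\<lambda>i. (E i 0 - E i 1) mod int s"] \<open>0 < s\<close>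
    by (auto simp: image_subset_iff)
  also have "\<dots> = (\<Sum>h\<in>{0..<int s}. x)"
  proof (rule sum.cong[OF refl])
    fix h assume "h \<in> {0..<int s}"
    then show "card {i\<in>{..<m}. (E i 0 - E i 1) mod int s = h} = x"
      using uniform_columnsD[OF E, of 0 1 h] \<open>2 \<le> m\<close> by (simp add: cong_def)
  qed
  finally show ?thesis by simp
qed

lemma uniform_rows:
  assumes E: "uniform_columns m s x E" and s: "0 < s" and m: "m = x * s"
    and i: "i < m" and i': "i' < m" and ne: "i \<noteq> i'"
  shows "card {c\<in>{..<m}. [E i c - E i' c = g] (mod int s)} = x"
proof -
  let ?S = "{0..<int s}"
  let ?f = "\<lambda>k c. (E i c - E k c) mod int s"
  let ?N = "\<lambda>k h. card {c\<in>{..<m}. ?f k c = h}"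
  let ?K = "{..<m} - {i}"
  have f: "?f k ` {..<m} \<subseteq> ?S" for k
    using s by (auto simp: image_subset_iff)
  have sum1: "(\<Sum>h\<in>?S. ?N k h) = m" for k
    using sum_card_fibres[OF _ _ f] by simp
  have sum2: "(\<Sum>h\<in>?S. (?N k h)\<^sup>2) = (\<Sum>c<m. card {c'\<in>{..<m}. ?f k c' = ?f k c})" for k
    using sum_card_fibres_squared[OF _ _ f] by simp
  \<comment> \<open>The sum includes \<open>k = i\<close>, so that for each pair of columns all
    \<open>m\<close> rows are counted.\<close>
  have "(\<Sum>k<m. \<Sum>h\<in>?S. (?N k h)\<^sup>2) =
      (\<Sum>c<m. \<Sum>k<m. card {c'\<in>{..<m}. ?f k c' = ?f k c})"
    unfolding sum2 by (rule sum.swap)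
  also have "\<dots> = (\<Sum>c<m. \<Sum>c'<m. card {k\<in>{..<m}. ?f k c' = ?f k c})"
    by (intro sum.cong refl sum_card_swap) auto
  also have "\<dots> = (\<Sum>c<m. \<Sum>c'<m. if c' = c then m else x)"
  proof (intro sum.cong refl)
    fix c c' assume c: "c \<in> {..<m}" "c' \<in> {..<m}"
    \<comment> \<open>Rows \<open>i\<close> and \<open>k\<close> have equal differences in two
      columns iff those columns differ in row \<open>k\<close> as they do in row \<open>i\<close>.
      This turns a row condition into a column difference.\<close>
    have "?f k c' = ?f k c \<longleftrightarrow> [E k c' - E k c = E i c' - E i c] (mod int s)" for k
      unfolding cong_def[symmetric] by (rule cong_iff_neg_diff) simp
    then show "card {k\<in>{..<m}. ?f k c' = ?f k c} = (if c' = c then m else x)"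
      using uniform_columnsD[OF E, of c' c "E i c' - E i c"] c by simp
  qed
  also have "\<dots> = m * (m + (m - 1) * x)"
    by (simp add: sum_off_diagonal)
  finally have "(\<Sum>k<m. \<Sum>h\<in>?S. (?N k h)\<^sup>2) = m * (m + (m - 1) * x)" .
  \<comment> \<open>Row \<open>i\<close> minus itself is zero, so one fibre holds all
    \<open>m\<close> columns; removing this term leaves the genuine row differences.\<close>
  moreover have "(\<Sum>h\<in>?S. (?N i h)\<^sup>2) = m * m"
    unfolding sum2 by simp
  ultimately have sq: "(\<Sum>k\<in>?K. \<Sum>h\<in>?S. (?N k h)\<^sup>2) = m * (m - 1) * x"
    using sum.remove[of "{..<m}" i "\<lambda>k. \<Sum>h\<in>?S. (?N k h)\<^sup>2"] i by (simp add: algebra_simps)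
  \<comment> \<open>With \<open>m = x * s\<close> the three terms are \<open>m(m-1)x\<close>,
    \<open>-2m(m-1)x\<close> and \<open>m(m-1)x\<close>.\<close>
  have "(\<Sum>k\<in>?K. \<Sum>h\<in>?S. (int (?N k h) - int x)\<^sup>2) =
      int (\<Sum>k\<in>?K. \<Sum>h\<in>?S. (?N k h)\<^sup>2) - 2 * int x * int (\<Sum>k\<in>?K. \<Sum>h\<in>?S. ?N k h)
      + int (\<Sum>k\<in>?K. \<Sum>h\<in>?S. x\<^sup>2)"
    by (simp add: power2_diff sum.distrib sum_subtractf sum_distrib_left algebra_simps)
  also have "\<dots> = 0"
    unfolding sq sum1 using i by (simp add: m power2_eq_square algebra_simps)
  finally have "\<forall>k\<in>?K. \<forall>h\<in>?S. (int (?N k h) - int x)\<^sup>2 = 0"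
    by (simp add: sum_nonneg_eq_0_iff sum_nonneg)
  then have "?N i' (g mod int s) = x"
    using i' ne s by auto
  then show ?thesis by (simp add: cong_def)
qed

section \<open>The design developed from a difference matrix\<close>

text \<open>Block \<open>c * s + g\<close> is the translate by \<open>g\<close> of the graph of column \<open>c\<close>.\<close>

definition developed_block :: "nat \<Rightarrow> nat \<Rightarrow> (nat \<Rightarrow> nat \<Rightarrow> int) \<Rightarrow> nat \<Rightarrow> (nat \<times> nat) set" where
  "developed_block m s E J =
     {(i, j). i < m \<and> j < s \<and> [int j = E i (J div s) + int (J mod s)] (mod int s)}"

lemma mem_developed_block:
  "(i, j) \<in> developed_block m s E J \<longleftrightarrow>
     i < m \<and> j < s \<and> [int j = E i (J div s) + int (J mod s)] (mod int s)"
  by (simp add: developed_block_def)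

section \<open>Cells of a block and blocks through a cell\<close>

lemma residue_unique:
  assumes "p < s" "p' < s" "[int p = a] (mod int s)" "[int p' = a] (mod int s)"
  shows "p = p'"
  using assms by (simp add: cong_def)

lemma nat_mod_residue:
  assumes "0 < s"
  shows "nat (a mod int s) < s" "[int (nat (a mod int s)) = a] (mod int s)"
  using assms by (simp_all add: cong_def nat_less_iff)

lemma cong_diff_swap:
  fixes p q a n :: int
  shows "[p = a + q] (mod n) \<longleftrightarrow> [q = p - a] (mod n)"
  by (rule cong_iff_neg_diff) simp

text \<open>A block is a graph over the array rows, so projection to the row is a bijection.\<close>

lemma card_rows_developed_block:
  assumes "0 < s"
  shows "card {t \<in> developed_block m s E J. P (fst t)} = card {i\<in>{..<m}. P i}"
proof (rule bij_betw_same_card)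
  show "bij_betw fst {t \<in> developed_block m s E J. P (fst t)} {i\<in>{..<m}. P i}"
    unfolding bij_betw_def
  proof (intro conjI inj_onI equalityI subsetI)
    fix t u assume "t \<in> {t \<in> developed_block m s E J. P (fst t)}"
      "u \<in> {t \<in> developed_block m s E J. P (fst t)}" "fst t = fst u"
    then show "t = u"
      by (cases t; cases u) (auto simp: mem_developed_block intro: residue_unique)
  next
    fix i assume i: "i \<in> {i\<in>{..<m}. P i}"
    let ?j = "nat ((E i (J div s) + int (J mod s)) mod int s)"
    have "(i, ?j) \<in> {t \<in> developed_block m s E J. P (fst t)}"
      using i nat_mod_residue[OF assms] by (simp add: mem_developed_block)
    then show "i \<in> fst ` {t \<in> developed_block m s E J. P (fst t)}"
      by force
  qed (auto simp: mem_developed_block)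
qed

lemma developed_blocks_same_class:
  assumes "t \<in> developed_block m s E J" "t \<in> developed_block m s E J'" "J div s = J' div s" "0 < s"
  shows "J = J'"
proof -
  obtain i j where t: "t = (i, j)" by fastforce
  have "J mod s = J' mod s"
  proof (rule residue_unique)
    \<comment> \<open>A cell determines the translate of a given column on which it lies.\<close>
    show "[int (J mod s) = int j - E i (J div s)] (mod int s)"
      "[int (J' mod s) = int j - E i (J div s)] (mod int s)"
      using assms unfolding t mem_developed_block cong_diff_swap by simp_all
  qed (use assms in simp_all)
  with assms(3) show ?thesis by (metis div_mult_mod_eq)
qed

text \<open>Each class has exactly one block through a given cell, so counting blocks becomes
  counting columns. The predicate \<open>P\<close> covers replication, resolvability and
  concurrences alike.\<close>

lemma card_classes_developed_block:
  assumes "0 < s" "i < m" "j < s"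
  shows "card {J. J < s * r \<and> (i, j) \<in> developed_block m s E J \<and> P (J div s)} =
    card {c\<in>{..<r}. P c}" (is "card ?A = card ?C")
proof (rule bij_betw_same_card)
  show "bij_betw (\<lambda>J. J div s) ?A ?C"
    unfolding bij_betw_def
  proof (intro conjI inj_onI equalityI subsetI)
    fix J J' assume "J \<in> ?A" "J' \<in> ?A" "J div s = J' div s"
    then show "J = J'" using developed_blocks_same_class assms(1) by blast
  next
    fix c assume "c \<in> (\<lambda>J. J div s) ` ?A"
    then show "c \<in> ?C"
      using assms(1) by (auto simp: less_mult_imp_div_less mult.commute)
  next
    fix c assume c: "c \<in> ?C"
    \<comment> \<open>The translation carrying the graph of column \<open>c\<close> through the cell
      \<open>(i, j)\<close>.\<close>
    let ?g = "nat ((int j - E i c) mod int s)"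
    have g: "?g < s" "[int ?g = int j - E i c] (mod int s)"
      using nat_mod_residue[OF assms(1)] by auto
    have "c * s + ?g < Suc c * s" using g by simp
    also have "\<dots> \<le> r * s" using c by (intro mult_right_mono) auto
    finally have lt: "c * s + ?g < s * r" by (simp add: mult.commute)
    have "[int j = E i c + int ?g] (mod int s)"
      using g(2) cong_diff_swap by blast
    then have "c * s + ?g \<in> ?A"
      using lt g c assms by (simp add: mem_developed_block)
    moreover have "(c * s + ?g) div s = c" using g by simp
    ultimately show "c \<in> (\<lambda>J. J div s) ` ?A" by force
  qed
qed

text \<open>Equating the two values in row \<open>fst t\<close> eliminates the array column and
  leaves a difference of columns of \<open>E\<close>.\<close>

lemma mem_both_blocks_iff:
  assumes "t \<in> developed_block m s E J"
  shows "t \<in> developed_block m s E J' \<longleftrightarrow>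
    [E (fst t) (J div s) - E (fst t) (J' div s) = int (J' mod s) - int (J mod s)] (mod int s)"
proof -
  obtain i j where t: "t = (i, j)" by fastforce
  from assms have j: "i < m" "j < s" "[int j = E i (J div s) + int (J mod s)] (mod int s)"
    by (auto simp: t mem_developed_block)
  have "t \<in> developed_block m s E J' \<longleftrightarrow>
      [E i (J div s) + int (J mod s) = E i (J' div s) + int (J' mod s)] (mod int s)"
    using j by (auto simp: t mem_developed_block cong_def)
  also have "\<dots> \<longleftrightarrow> [E i (J div s) - E i (J' div s) = int (J' mod s) - int (J mod s)] (mod int s)"
    by (simp add: cong_iff_dvd_diff algebra_simps)
  finally show ?thesis by (simp add: t)
qed

text \<open>Dually, equating the translations required by the two cells eliminates
  \<open>J mod s\<close> and leaves a difference of rows of \<open>E\<close>.\<close>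

lemma block_contains_both_iff:
  assumes "(i, j) \<in> developed_block m s E J" "i' < m" "j' < s"
  shows "(i', j') \<in> developed_block m s E J \<longleftrightarrow>
    [E i (J div s) - E i' (J div s) = int j - int j'] (mod int s)"
proof -
  have "[int (J mod s) = int j - E i (J div s)] (mod int s)"
    using assms(1) unfolding mem_developed_block cong_diff_swap by simp
  then have "(i', j') \<in> developed_block m s E J \<longleftrightarrow>
      [int j - E i (J div s) = int j' - E i' (J div s)] (mod int s)"
    using assms(2,3) unfolding mem_developed_block cong_diff_swap by (auto simp: cong_def)
  also have "\<dots> \<longleftrightarrow> [E i (J div s) - E i' (J div s) = int j - int j'] (mod int s)"
    by (rule cong_iff_neg_diff) simp
  finally show ?thesis .
qed

section \<open>Concurrences of treatments\<close>

lemma card_Collect_lessThan_Suc: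
  "card {c\<in>{..<Suc n}. P c} = card {c\<in>{..<n}. P c} + (if P n then 1 else 0)"
proof -
  have "{c\<in>{..<Suc n}. P c} = (if P n then insert n {c\<in>{..<n}. P c} else {c\<in>{..<n}. P c})"
    by (auto simp: less_Suc_eq)
  then show ?thesis by simp
qed

lemma developed_rectangular_design:
  assumes E: "uniform_columns m s x E" and s: "0 < s" and m: "m = x * s"
    and zero: "\<And>i. E i (m - 1) = 0"
  shows "rectangular_design (m * s) (s * (m - 1)) (m - 1) m 0 (x - 1) x m s (developed_block m s E)"
  unfolding rectangular_design_def
proof (intro conjI allI ballI impI)
  fix J
  show "developed_block m s E J \<subseteq> treatments m s"
    by (auto simp: developed_block_def treatments_def)
  show "card (developed_block m s E J) = m"
    using card_rows_developed_block[OF s, of m E J "\<lambda>_. True"] by simp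
next
  fix t assume "t \<in> treatments m s"
  then show "card {J. J < s * (m - 1) \<and> t \<in> developed_block m s E J} = m - 1"
    using card_classes_developed_block[OF s, of "fst t" m "snd t" "m - 1" E "\<lambda>_. True"]
    by (auto simp: treatments_def)
next
  fix t u assume tu: "t \<in> treatments m s" "u \<in> treatments m s" "t \<noteq> u"
  obtain i j i' j' where t: "t = (i, j)" and u: "u = (i', j')" by fastforce
  from tu have ij: "i < m" "j < s" "i' < m" "j' < s" by (auto simp: t u treatments_def)
  let ?P = "\<lambda>c. [E i c - E i' c = int j - int j'] (mod int s)"
  have same: "[0 = int j - int j'] (mod int s) \<longleftrightarrow> j = j'"
    using residue_unique[OF ij(2,4), of "int j'"]
    by (auto simp: cong_iff_dvd_diff dvd_diff_commute)
  have "{J. J < s * (m - 1) \<and> t \<in> developed_block m s E J \<and> u \<in> developed_block m s E J} =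
      {J. J < s * (m - 1) \<and> (i, j) \<in> developed_block m s E J \<and> ?P (J div s)}"
    using block_contains_both_iff ij unfolding t u by blast
  then have "card {J. J < s * (m - 1) \<and> t \<in> developed_block m s E J \<and> u \<in> developed_block m s E J} =
      card {c\<in>{..<m - 1}. ?P c}"
    using card_classes_developed_block[OF s ij(1,2)] by simp
  also have "\<dots> = (if i = i' then 0 else if j = j' then x - 1 else x)"
  proof (cases "i = i'")
    case True
    \<comment> \<open>In one array row the difference of \<open>E\<close> is zero while
      \<open>j\<close> and \<open>j'\<close> are distinct residues, so no column qualifies.\<close>
    then show ?thesis using same tu by (auto simp: t u)
  next
    case False
    \<comment> \<open>The zero column satisfies the condition exactly for equal array columns, and
      the uniform count over all \<open>m\<close> columns includes it.\<close>
    have last: "?P (m - 1) \<longleftrightarrow> j = j'" using same unfolding zero by simp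
    have "Suc (m - 1) = m" using ij by simp
    then have "x = card {c\<in>{..<m - 1}. ?P c} + (if j = j' then 1 else 0)"
      using uniform_rows[OF E s m ij(1,3) False, of "int j - int j'"]
        card_Collect_lessThan_Suc[of "m - 1" ?P] unfolding last by metis
    with False show ?thesis by simp
  qed
  finally show "card {J. J < s * (m - 1) \<and> t \<in> developed_block m s E J \<and> u \<in> developed_block m s E J} =
      (if fst t = fst u then 0 else if snd t = snd u then x - 1 else x)"
    by (simp add: t u)
qed simp

text \<open>Intersections of blocks reflect column differences only, so any initial \<open>r\<close>
  columns will do.\<close>

lemma developed_affine_resolvable:
  assumes E: "uniform_columns m s x E" and s: "0 < s" and "r \<le> m"
  shows "affine_resolvable m s (s * r) (developed_block m s E) 0 x"
proof -
  define cls where "cls c = {J. J < s * r \<and> J div s = c}" for c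
  have cls_ne: "cls c \<noteq> {}" if "c < r" for c
  proof -
    have "c * s \<in> cls c" using that s by (simp add: cls_def)
    then show ?thesis by blast
  qed
  have div_less: "J div s < r" if "J < s * r" for J
    using that by (simp add: less_mult_imp_div_less mult.commute)
  have "partition_on {..<s * r} (cls ` {..<r})"
    unfolding partition_on_def disjoint_def
    using cls_ne div_less by (auto simp: cls_def)
  moreover have "\<exists>!J. J \<in> cls c \<and> t \<in> developed_block m s E J"
    if "c < r" "t \<in> treatments m s" for c t
  proof -
    obtain i j where t: "t = (i, j)" "i < m" "j < s"
      using \<open>t \<in> treatments m s\<close> by (auto simp: treatments_def)
    \<comment> \<open>Counting columns equal to \<open>c\<close> gives 1, hence one block of class
      \<open>c\<close> through each cell.\<close>
    have "{c' \<in> {..<r}. c' = c} = {c}" using \<open>c < r\<close> by auto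
    then have "card {J. J < s * r \<and> t \<in> developed_block m s E J \<and> J div s = c} = 1"
      using card_classes_developed_block[OF s t(2,3), of r E "\<lambda>c'. c' = c"] by (simp add: t(1))
    then obtain J where J: "{J. J < s * r \<and> t \<in> developed_block m s E J \<and> J div s = c} = {J}"
      by (auto simp: card_1_singleton_iff)
    then show ?thesis
      by (intro ex1I[of _ J]) (auto simp: cls_def)
  qed
  moreover have "card (developed_block m s E J \<inter> developed_block m s E J') = 0"
    if "J \<in> cls c" "J' \<in> cls c" "J \<noteq> J'" for c J J'
  proof -
    have "developed_block m s E J \<inter> developed_block m s E J' = {}"
      using developed_blocks_same_class[OF _ _ _ s] that by (fastforce simp: cls_def)
    then show ?thesis by simp
  qed
  moreover have "card (developed_block m s E J \<inter> developed_block m s E J') = x"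
    if "c < r" "c' < r" "cls c \<noteq> cls c'" "J \<in> cls c" "J' \<in> cls c'" for c c' J J'
  proof -
    let ?P = "\<lambda>i. [E i c - E i c' = int (J' mod s) - int (J mod s)] (mod int s)"
    have J: "J div s = c" "J' div s = c'" using that by (auto simp: cls_def)
    have "developed_block m s E J \<inter> developed_block m s E J' =
        {t \<in> developed_block m s E J. ?P (fst t)}"
      using mem_both_blocks_iff[of _ m s E J J'] unfolding J by blast
    then have "card (developed_block m s E J \<inter> developed_block m s E J') = card {i\<in>{..<m}. ?P i}"
      using card_rows_developed_block[OF s] by simp
    also have "\<dots> = x"
    proof (rule uniform_columnsD[OF E])
      show "c < m" "c' < m" "c \<noteq> c'" using that \<open>r \<le> m\<close> by auto
    qed
    finally show ?thesis .
  qed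
  ultimately show ?thesis
    unfolding affine_resolvable_def is_resolution_def
    by (intro exI[of _ "cls ` {..<r}"]) auto
qed

section \<open>Row and column sums of the incidence submatrices\<close>

lemma sum_indicator_unique:
  fixes s :: nat
  assumes "\<exists>!p. p < s \<and> P p"
  shows "(\<Sum>p<s. if P p then 1 else 0 :: nat) = 1"
proof -
  obtain p where "p < s" and P: "\<And>q. q < s \<Longrightarrow> P q \<longleftrightarrow> q = p"
    using assms by blast
  from P have "(\<Sum>q<s. if P q then 1 else 0 :: nat) = (\<Sum>q<s. if q = p then 1 else 0)"
    by (intro sum.cong) simp_all
  with \<open>p < s\<close> show ?thesis by simp
qed

lemma residue_ex1:
  assumes "0 < s"
  shows "\<exists>!p. p < s \<and> [int p = a] (mod int s)"
  using nat_mod_residue[OF assms, of a] residue_unique by blast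

text \<open>The submatrix for array row \<open>I\<close> and class \<open>J\<close> is a circulant
  permutation matrix with shift \<open>E I J\<close>, so all its row and column sums are 1.\<close>

lemma developed_STD:
  assumes s: "0 < s"
  shows "STD s m s (s * r) (developed_block m s E)"
proof -
  let ?N = "incidence_mat m s (s * r) (developed_block m s E)"
  have entry: "?N $$ (I * s + p, J * s + q) =
      (if [int p = E I J + int q] (mod int s) then 1 else 0)"
    if "I < m" "J < r" "p < s" "q < s" for I J p q
  proof -
    have "I * s + p < Suc I * s" "J * s + q < Suc J * s" using that by simp_all
    moreover have "Suc I * s \<le> m * s" "Suc J * s \<le> r * s"
      using that by (intro mult_right_mono; simp)+
    ultimately have "I * s + p < m * s" "J * s + q < s * r"
      by (simp_all add: mult.commute)
    then show ?thesis
      using that by (simp add: incidence_mat_def mem_developed_block)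
  qed
  have "(\<Sum>q<s. ?N $$ (I * s + p, J * s + q)) = 1" if "I < m" "J < r" "p < s" for I J p
  proof -
    have "(\<Sum>q<s. ?N $$ (I * s + p, J * s + q)) =
        (\<Sum>q<s. if [int q = int p - E I J] (mod int s) then 1 else 0)"
      using that by (intro sum.cong) (simp_all add: entry cong_diff_swap[of "int p"])
    also have "\<dots> = 1" by (rule sum_indicator_unique[OF residue_ex1[OF s]])
    finally show ?thesis .
  qed
  moreover have "(\<Sum>p<s. ?N $$ (I * s + p, J * s + q)) = 1" if "I < m" "J < r" "q < s" for I J q
  proof -
    have "(\<Sum>p<s. ?N $$ (I * s + p, J * s + q)) =
        (\<Sum>p<s. if [int p = E I J + int q] (mod int s) then 1 else 0)"
      using that by (intro sum.cong) (simp_all add: entry)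
    also have "\<dots> = 1" by (rule sum_indicator_unique[OF residue_ex1[OF s]])
    finally show ?thesis .
  qed
  moreover have "dim_row ?N = m * s" "dim_col ?N = s * r"
    by (simp_all add: incidence_mat_def)
  ultimately show ?thesis
    using s unfolding STD_def square_tactical_def by auto
qed

section \<open>Parameters, and normalisation of the difference scheme\<close>

lemma latin_semi_regular_parameters:
  assumes "0 < s" "0 < x"
  shows "latin_semi_regular (x * s - 1) 0 (x - 1) x (x * s) s"
proof -
  \<comment> \<open>Positivity makes the natural-number subtractions exact; then
    \<open>theta3\<close> evaluates to \<open>x * s\<close>.\<close>
  have "1 \<le> x * s" using assms by (simp add: Suc_le_eq)
  then have "int (x * s - 1) = int x * int s - 1" by simp
  moreover have "int (x - 1) = int x - 1" using assms by simp
  ultimately show ?thesis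
    using assms unfolding latin_semi_regular_def theta1_def theta2_def theta3_def
    by (simp add: algebra_simps)
qed

lemma difference_scheme_uniform_columns:
  assumes "difference_scheme m s x D" "0 < s"
  shows "uniform_columns m s x (\<lambda>i c. D $$ (i, c) - D $$ (i, m - 1))"
  unfolding uniform_columns_def
proof (intro allI impI)
  fix c c' g assume "c < m" "c' < m" "c \<noteq> c'"
  moreover have "g mod int s \<in> {0..<int s}" using assms(2) by simp
  ultimately have "card {i. i < m \<and> (D $$ (i, c) - D $$ (i, c')) mod int s = g mod int s} = x"
    using assms(1) unfolding difference_scheme_def by blast
  then show "card {i\<in>{..<m}. [(D $$ (i, c) - D $$ (i, m - 1)) - (D $$ (i, c') - D $$ (i, m - 1)) = g]
      (mod int s)} = x"
    by (simp add: cong_def)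
qed

theorem theorem10:
  fixes m s x :: nat
  assumes "s \<ge> 2" and "m \<ge> 2"
    and "\<exists>D. difference_scheme m s x D"
  shows "m = x * s \<and>
    (\<exists>B. rectangular_design (x * s\<^sup>2) (s * (x * s - 1)) (x * s - 1) (x * s) 0 (x - 1) x (x * s) s B \<and>
         latin_semi_regular (x * s - 1) 0 (x - 1) x (x * s) s \<and>
         affine_resolvable (x * s) s (s * (x * s - 1)) B 0 x \<and>
         STD s (x * s) s (s * (x * s - 1)) B)"
proof -
  have s: "0 < s" using assms(1) by simp
  obtain D where D: "difference_scheme m s x D" using assms(3) by blast
  define E where "E i c = D $$ (i, c) - D $$ (i, m - 1)" for i c
  have E: "uniform_columns m s x E"
    using difference_scheme_uniform_columns[OF D s] by (simp add: E_def[abs_def])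
  have m: "m = x * s"
    using uniform_columns_order[OF E s assms(2)] .
  \<comment> \<open>\<open>x = 0\<close> would give \<open>m = 0\<close>.\<close>
  have "0 < x" using m assms(2) by (cases x) auto
  moreover have "x * s\<^sup>2 = m * s" by (simp add: m power2_eq_square)
  moreover have "E i (m - 1) = 0" for i by (simp add: E_def)
  ultimately show ?thesis
    using developed_rectangular_design[OF E s m] developed_affine_resolvable[OF E s, of "m - 1"]
      developed_STD[OF s, of m "m - 1" E] latin_semi_regular_parameters[OF s] m
    by (metis diff_le_self)
qed

end
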